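(* Let $(W,H,\mu)$ be an abstract Wiener space. Let $U_n=I_W+u_n$, $n\ge1$, be a sequence of shifts, where $u_n\in\mathbb{D}_{p,1}(H)$ for some $p>1$. Assume that $U_n\mu\ll\mu$ for all $n\ge1$ and denote $L_n=\frac{dU_n\mu}{d\mu}$. Assume further that $L_n\circ U_n\,\Lambda(U_n)=1$ a.s. for all $n\ge1$, that $L_n\to L$ in $L^1(\mu)$, and that $U_n\to U=I_W+u$ in $L^0(\mu,W)$ (convergence in probability). Then $L_n\circ U_n\to L\circ U$ in $L^0(\mu)$, the sequence $(\Lambda(U_n))_{n\ge1}$ converges in $L^0(\mu)$ to a limit, denoted $\lambda(U)$, and $$L\circ U\,\lambda(U)=1\quad\text{a.s.}$$ Besides, under the additional hypothesis $$\sup_nE[\log^-L_n]<\infty ,$$ the sequence $(\Lambda(U_n),n\ge1)$ is uniformly integrable, hence it converges to $\lambda(U)$ also in $L^1(\mu)$, and $$E[f\circ U\,\lambda(U)]=E[f]$$ for any $f\in C_b(W)$.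
   Context: An abstract Wiener space $(W,H,\mu)$: $W$ is a separable Fréchet space, $H\subset W$ a separable Hilbert space densely and continuously injected (the Cameron-Martin space), $\mu$ the standard Gaussian measure on $W$, i.e. $\int e^{i\langle l,w\rangle}d\mu(w)=e^{-\frac12|l|_H^2}$ for $l\in W^\star\subset H^\star= H$. $E$ denotes expectation under $\mu$; $U\mu$ is the image of $\mu$ under $U:W\to W$. $\nabla$ is the Sobolev derivative: the closure in $L^p(\mu)$ of the Gateaux derivative along $H$ of smooth cylindrical functions (extended to $H$-valued functions, with $\nabla u$ Hilbert-Schmidt-operator-valued); $\mathbb{D}_{p,1}(H)$ is the space of $u\in L^p(\mu,H)$ with $\nabla u\in L^p(\mu;H\otimes H)$. $\delta$ is the divergence, the adjoint of $\nabla$: $\int(\xi,\nabla f)_H\,d\mu=\int f\,\delta\xi\,d\mu$. For $U=I_W+u$ with $u\in\mathbb{D}_{p,1}(H)$, $$\Lambda(U)=\mathrm{det}_2(I_H+\nabla u)\exp\left(-\delta u-\tfrac12|u|_H^2\right),$$ where $\mathrm{det}_2$ is the modified Carleman-Fredholm determinant: $\mathrm{det}_2(I_H+A)=\det(I_H+A)e^{-\mathrm{trace}\,A}$ for nuclear $A$, extended continuously to Hilbert-Schmidt $A$. $\log^-x=\max(-\log x,0)$, with $\log^-0=+\infty$. *)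

theory Defs
  imports "HOL-Probability.Probability"
begin

section \<open>Abstract Wiener spaces\<close>

text \<open>The metric of the class is a complete translation-invariant metric inducing the topology;
  separability is part of \<^class>\<open>polish_space\<close>.\<close>

class separable_frechet_space = real_vector + polish_space +
  assumes dist_translation_invariant: "dist (x + z) (y + z) = dist x y"
    and tendsto_scaleR_joint: "((\<lambda>(s, y). s *\<^sub>R y) \<longlongrightarrow> r *\<^sub>R x) (nhds r \<times>\<^sub>F nhds x)"
    and locally_convex_at_0: "open S \<Longrightarrow> 0 \<in> S \<Longrightarrow> \<exists>V. open V \<and> 0 \<in> V \<and> V \<subseteq> S \<and>
      (\<forall>x\<in>V. \<forall>y\<in>V. \<forall>t. 0 \<le> t \<longrightarrow> t \<le> 1 \<longrightarrow> (1 - t) *\<^sub>R x + t *\<^sub>R y \<in> V)"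

definition continuous_dual :: "('w::separable_frechet_space \<Rightarrow> real) set" where
  "continuous_dual = {l. linear l \<and> continuous_on UNIV l}"

text \<open>The Hilbert space is a separate type, injected by \<open>\<iota>\<close>. For \<open>l\<close> in the dual of \<open>W\<close>, the norm of
  \<open>l\<close> in \<open>H\<^sup>* = H\<close> is the operator norm of the functional \<open>l \<circ> \<iota>\<close> on \<open>H\<close>.\<close>

definition abstract_wiener_space ::
  "'w::separable_frechet_space measure \<Rightarrow> ('h::{real_inner,polish_space} \<Rightarrow> 'w) \<Rightarrow> bool" where
  "abstract_wiener_space \<mu> \<iota> \<longleftrightarrow>
     linear \<iota> \<and> inj \<iota> \<and> continuous_on UNIV \<iota> \<and> closure (range \<iota>) = UNIV \<and>
     sets \<mu> = sets borel \<and> prob_space \<mu> \<and>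
     (\<forall>l\<in>continuous_dual.
        (LINT w|\<mu>. iexp (l w)) = complex_of_real (exp (- ((onorm (l \<circ> \<iota>))\<^sup>2 / 2))))"


section \<open>Hilbert-Schmidt and nuclear operators, determinants\<close>

definition orthonormal_basis :: "'h::real_inner set \<Rightarrow> bool" where
  "orthonormal_basis B \<longleftrightarrow>
     pairwise orthogonal B \<and> (\<forall>e\<in>B. norm e = 1) \<and> closure (span B) = UNIV"

text \<open>None of the quantities below depends on the choice of the basis.\<close>

definition onb :: "'h::real_inner set" where
  "onb = (SOME B. orthonormal_basis B)"

lemma orthonormal_extend:
  fixes S :: "'h::real_inner set" and x :: 'h
  assumes fin: "finite S" and orth: "pairwise orthogonal S" and nrm: "\<forall>e\<in>S. norm e = 1"
  shows "\<exists>T. finite T \<and> pairwise orthogonal T \<and> (\<forall>e\<in>T. norm e = 1) \<and> S \<subseteq> T \<and> x \<in> span T"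
proof -
  define p where "p = (\<Sum>e\<in>S. inner x e *\<^sub>R e)"
  define y where "y = x - p"
  have p: "p \<in> span S"
    unfolding p_def by (intro span_sum span_scale span_base)
  have y: "inner y d = 0" if "d \<in> S" for d
  proof -
    have "inner p d = (\<Sum>e\<in>S. if e = d then inner x d else 0)"
      unfolding p_def inner_sum_left
      using orth nrm that
      by (intro sum.cong) (auto simp: pairwise_def orthogonal_def norm_eq_1)
    then show ?thesis
      using fin that by (simp add: y_def inner_diff_left)
  qed
  show ?thesis
  proof (cases "y = 0")
    case True
    then show ?thesis using assms p by (intro exI[of _ S]) (auto simp: y_def)
  next
    case False
    define z where "z = y /\<^sub>R norm y"
    have "x = norm y *\<^sub>R z + p" using False by (simp add: z_def y_def)
    moreover have "norm y *\<^sub>R z + p \<in> span (insert z S)"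
      using p span_mono[OF subset_insertI, of S z] by (blast intro: span_add span_scale span_base)
    ultimately have "x \<in> span (insert z S)" by simp
    moreover have "pairwise orthogonal (insert z S)"
      using orth y by (auto simp: pairwise_insert orthogonal_def z_def inner_commute)
    moreover have "norm z = 1" using False by (simp add: z_def)
    ultimately show ?thesis using fin nrm by (intro exI[of _ "insert z S"]) auto
  qed
qed

lemma orthonormal_basis_onb: "orthonormal_basis (onb :: 'h::{real_inner,polish_space} set)"
proof -
  obtain D :: "'h set" where D: "countable D" "\<And>X. open X \<Longrightarrow> X \<noteq> {} \<Longrightarrow> \<exists>d\<in>D. d \<in> X"
    using countable_dense_setE by metis
  let ?P = "\<lambda>S :: 'h set. finite S \<and> pairwise orthogonal S \<and> (\<forall>e\<in>S. norm e = 1)"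
  have "\<exists>S. \<forall>n. ?P (S n) \<and> (S n \<subseteq> S (Suc n) \<and> from_nat_into D n \<in> span (S (Suc n)))"
  proof (rule dependent_nat_choice)
    show "\<exists>S. ?P S" by (intro exI[of _ "{}"]) auto
  next
    fix S n assume "?P S"
    then show "\<exists>T. ?P T \<and> (S \<subseteq> T \<and> from_nat_into D n \<in> span T)"
      using orthonormal_extend[of S "from_nat_into D n"] by simp
  qed
  then obtain S where
    "\<forall>n. ?P (S n) \<and> (S n \<subseteq> S (Suc n) \<and> from_nat_into D n \<in> span (S (Suc n)))" ..
  then have S: "\<And>n. ?P (S n)" "\<And>n. S n \<subseteq> S (Suc n)"
    "\<And>n. from_nat_into D n \<in> span (S (Suc n))" by simp_all
  define B where "B = (\<Union>n. S n)"
  have mono: "S m \<subseteq> S n" if "m \<le> n" for m n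
    by (rule lift_Suc_mono_le[of S, OF S(2) that])
  have "pairwise orthogonal B"
  proof (rule pairwiseI)
    fix a b assume "a \<in> B" "b \<in> B" "a \<noteq> b"
    then obtain m n where "a \<in> S m" "b \<in> S n" by (auto simp: B_def)
    then have "a \<in> S (max m n)" "b \<in> S (max m n)"
      using mono[of m "max m n"] mono[of n "max m n"] by auto
    then show "orthogonal a b" using S(1)[of "max m n"] \<open>a \<noteq> b\<close> by (auto simp: pairwise_def)
  qed
  moreover have "\<forall>e\<in>B. norm e = 1" using S(1) by (auto simp: B_def)
  moreover have "D \<subseteq> span B"
  proof
    fix d assume "d \<in> D"
    then obtain n where "d = from_nat_into D n" using from_nat_into_surj[OF D(1)] by metis
    then show "d \<in> span B"
      using S(3)[of n] span_mono[of "S (Suc n)" B] by (auto simp: B_def)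
  qed
  then have "closure (span B) = UNIV"
    using D(2)[of "- closure (span B)"] closure_subset[of "span B"]
    by (auto simp: open_Compl)
  ultimately have "orthonormal_basis B" by (simp add: orthonormal_basis_def)
  then show ?thesis unfolding onb_def by (rule someI)
qed

definition hilbert_schmidt :: "('h::real_inner \<Rightarrow> 'h) \<Rightarrow> bool" where
  "hilbert_schmidt A \<longleftrightarrow> bounded_linear A \<and> (\<lambda>e. (norm (A e))\<^sup>2) summable_on onb"

definition hs_norm :: "('h::real_inner \<Rightarrow> 'h) \<Rightarrow> real" where
  "hs_norm A = sqrt (\<Sum>\<^sub>\<infinity>e\<in>onb. (norm (A e))\<^sup>2)"

definition nuclear :: "('h::real_inner \<Rightarrow> 'h) \<Rightarrow> bool" where
  "nuclear A \<longleftrightarrow> (\<exists>a b :: nat \<Rightarrow> 'h. summable (\<lambda>k. norm (a k) * norm (b k)) \<and>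
     (\<forall>x. (\<lambda>k. inner (a k) x *\<^sub>R b k) sums A x))"

definition op_trace :: "('h::real_inner \<Rightarrow> 'h) \<Rightarrow> real" where
  "op_trace A = (\<Sum>\<^sub>\<infinity>e\<in>onb. inner (A e) e)"

text \<open>The Fredholm determinant \<open>det (I + A) = (\<Sum>k. tr (\<Lambda>\<^sup>k A))\<close> of a nuclear \<open>A\<close>: the trace of the
  \<open>k\<close>-th exterior power is the sum of the principal \<open>k \<times> k\<close> minors of the matrix of \<open>A\<close>.\<close>

definition principal_minor :: "('h::real_inner \<Rightarrow> 'h) \<Rightarrow> 'h set \<Rightarrow> real" where
  "principal_minor A S = (\<Sum>\<pi> | \<pi> permutes S. of_int (sign \<pi>) * (\<Prod>e\<in>S. inner (A e) (\<pi> e)))"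

definition fredholm_det :: "('h::real_inner \<Rightarrow> 'h) \<Rightarrow> real" where
  "fredholm_det A = (\<Sum>\<^sub>\<infinity>S\<in>{S. finite S \<and> S \<subseteq> onb}. principal_minor A S)"

text \<open>\<open>det2 A\<close> stands for \<open>det\<^sub>2 (I + A)\<close>: the continuous extension, in Hilbert-Schmidt norm, of
  \<open>det (I + A) exp (- trace A)\<close> from nuclear to Hilbert-Schmidt operators.\<close>

definition det2 :: "('h::real_inner \<Rightarrow> 'h) \<Rightarrow> real" where
  "det2 A = (THE d. \<forall>X :: nat \<Rightarrow> 'h \<Rightarrow> 'h.
     (\<forall>n. nuclear (X n)) \<longrightarrow> (\<lambda>n. hs_norm (\<lambda>h. X n h - A h)) \<longlonglongrightarrow> 0 \<longrightarrow>
     (\<lambda>n. fredholm_det (X n) * exp (- op_trace (X n))) \<longlonglongrightarrow> d)"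


section \<open>Sobolev derivative and divergence\<close>

text \<open>\<open>\<phi>\<close> is a smooth function of its first \<open>k\<close> arguments, all of whose partial derivatives are
  bounded: \<open>D [j\<^sub>1, \<dots>, j\<^sub>m]\<close> is the iterated partial derivative in the directions \<open>j\<^sub>m, \<dots>, j\<^sub>1\<close>.
  (Existence and boundedness of all of these forces their continuity in the first \<open>k\<close> arguments.)\<close>

definition smooth_bounded :: "nat \<Rightarrow> ((nat \<Rightarrow> real) \<Rightarrow> real) \<Rightarrow> bool" where
  "smooth_bounded k \<phi> \<longleftrightarrow> (\<exists>D :: nat list \<Rightarrow> (nat \<Rightarrow> real) \<Rightarrow> real. D [] = \<phi> \<and>
     (\<forall>js. set js \<subseteq> {..<k} \<longrightarrow> bounded (range (D js)) \<and>
        (\<forall>j<k. \<forall>x. ((\<lambda>t. D js (x(j := t))) has_real_derivative D (j # js) x) (at (x j)))))"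

definition smooth_cylindrical :: "('w::separable_frechet_space \<Rightarrow> real) \<Rightarrow> bool" where
  "smooth_cylindrical f \<longleftrightarrow> (\<exists>k \<phi> l. smooth_bounded k \<phi> \<and> (\<forall>j<k. l j \<in> continuous_dual) \<and>
     f = (\<lambda>w. \<phi> (\<lambda>j. if j < k then l j w else 0)))"

definition smooth_cylindrical_H ::
  "('w::separable_frechet_space \<Rightarrow> 'h::real_vector) \<Rightarrow> bool" where
  "smooth_cylindrical_H F \<longleftrightarrow> (\<exists>(m :: nat) f h. (\<forall>j<m. smooth_cylindrical (f j)) \<and>
     F = (\<lambda>w. \<Sum>j<m. f j w *\<^sub>R h j))"

definition gateaux ::
  "('h \<Rightarrow> 'w::separable_frechet_space) \<Rightarrow> ('w \<Rightarrow> 'b::real_normed_vector) \<Rightarrow> 'w \<Rightarrow> 'h \<Rightarrow> 'b" where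
  "gateaux \<iota> F w h = vector_derivative (\<lambda>t. F (w + t *\<^sub>R \<iota> h)) (at 0)"

definition H_gradient ::
  "('h::real_inner \<Rightarrow> 'w::separable_frechet_space) \<Rightarrow> ('w \<Rightarrow> real) \<Rightarrow> 'w \<Rightarrow> 'h" where
  "H_gradient \<iota> f w = (THE g. \<forall>h. inner g h = gateaux \<iota> f w h)"

text \<open>Elements of \<open>H \<otimes> H\<close> are represented by Hilbert-Schmidt operators \<open>h \<mapsto> \<nabla>\<^sub>h u\<close>.\<close>

definition sobolev_derivative ::
  "'w::separable_frechet_space measure \<Rightarrow> ('h::{real_inner,polish_space} \<Rightarrow> 'w) \<Rightarrow> real \<Rightarrow>
   ('w \<Rightarrow> 'h) \<Rightarrow> ('w \<Rightarrow> 'h \<Rightarrow> 'h) \<Rightarrow> bool" where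
  "sobolev_derivative \<mu> \<iota> p u D \<longleftrightarrow>
     (\<forall>w. hilbert_schmidt (D w)) \<and> (\<forall>h. (\<lambda>w. D w h) \<in> borel_measurable \<mu>) \<and>
     integrable \<mu> (\<lambda>w. hs_norm (D w) powr p) \<and>
     (\<exists>F :: nat \<Rightarrow> 'w \<Rightarrow> 'h. (\<forall>k. smooth_cylindrical_H (F k)) \<and>
        (\<lambda>k. \<integral>\<^sup>+ w. ennreal (norm (F k w - u w) powr p) \<partial>\<mu>) \<longlonglongrightarrow> 0 \<and>
        (\<lambda>k. \<integral>\<^sup>+ w. ennreal (hs_norm (\<lambda>h. gateaux \<iota> (F k) w h - D w h) powr p) \<partial>\<mu>) \<longlonglongrightarrow> 0)"

definition sobolev_space ::
  "'w::separable_frechet_space measure \<Rightarrow> ('h::{real_inner,polish_space} \<Rightarrow> 'w) \<Rightarrow> real \<Rightarrow>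
   ('w \<Rightarrow> 'h) set" where
  "sobolev_space \<mu> \<iota> p = {u \<in> borel_measurable \<mu>.
     integrable \<mu> (\<lambda>w. norm (u w) powr p) \<and> (\<exists>D. sobolev_derivative \<mu> \<iota> p u D)}"

text \<open>Versions of the almost surely unique derivative and divergence.\<close>

definition nabla ::
  "'w::separable_frechet_space measure \<Rightarrow> ('h::{real_inner,polish_space} \<Rightarrow> 'w) \<Rightarrow> real \<Rightarrow>
   ('w \<Rightarrow> 'h) \<Rightarrow> 'w \<Rightarrow> 'h \<Rightarrow> 'h" where
  "nabla \<mu> \<iota> p u = (SOME D. sobolev_derivative \<mu> \<iota> p u D)"

definition divergence ::
  "'w::separable_frechet_space measure \<Rightarrow> ('h::{real_inner,polish_space} \<Rightarrow> 'w) \<Rightarrow>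
   ('w \<Rightarrow> 'h) \<Rightarrow> 'w \<Rightarrow> real" where
  "divergence \<mu> \<iota> \<xi> = (SOME d. integrable \<mu> d \<and>
     (\<forall>f. smooth_cylindrical f \<longrightarrow>
        (LINT w|\<mu>. inner (\<xi> w) (H_gradient \<iota> f w)) = (LINT w|\<mu>. f w * d w)))"

text \<open>\<open>Lambda \<mu> \<iota> p u\<close> is \<open>\<Lambda>(U)\<close> for the shift \<open>U = I\<^sub>W + u\<close>. As it is built from
  arbitrary versions of \<open>\<nabla>u\<close> and \<open>\<delta>u\<close>, it is a random variable only up to null sets, and is to be
  used as such on the completion of \<open>\<mu>\<close>.\<close>

definition wiener_shift ::
  "('h \<Rightarrow> 'w::separable_frechet_space) \<Rightarrow> ('w \<Rightarrow> 'h) \<Rightarrow> 'w \<Rightarrow> 'w" where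
  "wiener_shift \<iota> u w = w + \<iota> (u w)"

definition Lambda ::
  "'w::separable_frechet_space measure \<Rightarrow> ('h::{real_inner,polish_space} \<Rightarrow> 'w) \<Rightarrow> real \<Rightarrow>
   ('w \<Rightarrow> 'h) \<Rightarrow> 'w \<Rightarrow> real" where
  "Lambda \<mu> \<iota> p u w =
     det2 (nabla \<mu> \<iota> p u w) * exp (- divergence \<mu> \<iota> u w - (norm (u w))\<^sup>2 / 2)"


section \<open>Densities and modes of convergence\<close>

definition image_density ::
  "'w::separable_frechet_space measure \<Rightarrow> ('w \<Rightarrow> 'w) \<Rightarrow> 'w \<Rightarrow> real" where
  "image_density \<mu> T w = enn2real (RN_deriv \<mu> (distr \<mu> borel T) w)"

definition log_minus :: "real \<Rightarrow> ennreal" where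
  "log_minus x = (if x = 0 then \<infinity> else ennreal (max (- ln x) 0))"

definition L0_converges ::
  "'a measure \<Rightarrow> (nat \<Rightarrow> 'a \<Rightarrow> 'b::metric_space) \<Rightarrow> ('a \<Rightarrow> 'b) \<Rightarrow> bool" where
  "L0_converges M f g \<longleftrightarrow> (\<forall>n. f n \<in> borel_measurable M) \<and> g \<in> borel_measurable M \<and>
     (\<forall>\<epsilon>>0. (\<lambda>n. measure M {x \<in> space M. dist (f n x) (g x) > \<epsilon>}) \<longlonglongrightarrow> 0)"

definition L1_converges :: "'a measure \<Rightarrow> (nat \<Rightarrow> 'a \<Rightarrow> real) \<Rightarrow> ('a \<Rightarrow> real) \<Rightarrow> bool" where
  "L1_converges M f g \<longleftrightarrow> (\<forall>n. integrable M (f n)) \<and> integrable M g \<and>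
     (\<lambda>n. LINT x|M. \<bar>f n x - g x\<bar>) \<longlonglongrightarrow> 0"

definition uniformly_integrable :: "'a measure \<Rightarrow> (nat \<Rightarrow> 'a \<Rightarrow> real) \<Rightarrow> bool" where
  "uniformly_integrable M f \<longleftrightarrow> (\<forall>n. f n \<in> borel_measurable M) \<and>
     ((\<lambda>c. SUP n. \<integral>\<^sup>+ x. ennreal (\<bar>f n x\<bar> * indicator {y. \<bar>f n y\<bar> > c} x) \<partial>M) \<longlongrightarrow> 0) at_top"

end

theory Submission
  imports Defs
begin

text \<open>
  The identity \<open>L\<^sub>n \<circ> U\<^sub>n \<cdot> \<Lambda>(U\<^sub>n) = 1\<close> says that \<open>\<Lambda>(U\<^sub>n) = 1 / (L\<^sub>n \<circ> U\<^sub>n)\<close> almost surely, which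
  turns the claim into a statement about maps \<open>T\<^sub>n\<close> into a Polish
  space that converge in probability to \<open>S\<close> and whose laws have densities \<open>L\<^sub>n\<close> converging in \<open>L\<^sup>1\<close>
  to \<open>K\<close>.

  The laws of the \<open>T\<^sub>n\<close> converge in total variation to \<open>\<nu> = K \<cdot> M\<close>, and regularity of Borel
  measures identifies \<open>\<nu>\<close> as the law of \<open>S\<close> (\<open>distr_S\<close>). The point of the first part is that
  \<open>h \<circ> T\<^sub>n \<longrightarrow> h \<circ> S\<close> in probability for every Borel function \<open>h\<close>, continuous or not
  (\<open>compose_tendsto\<close>). Convergence in probability of \<open>T\<^sub>n\<close> alone gives this only for continuous \<open>h\<close>;
  but a Borel set lies between a compact and an open set of nearly equal \<open>\<nu>\<close>-measure, and the laws of
  all \<open>T\<^sub>n\<close> are uniformly close to \<open>\<nu>\<close>, so neither \<open>S\<close> nor \<open>T\<^sub>n\<close> charges the gap much. Applied to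
  \<open>h = K\<close>, and since \<open>|L\<^sub>n - K| > \<epsilon>\<close> has small \<open>M\<close>-measure and hence small \<open>\<nu>\<close>-measure, this gives
  \<open>L\<^sub>n \<circ> T\<^sub>n \<longrightarrow> K \<circ> S\<close>. The limit is almost surely positive because \<open>\<nu>\<close> does not charge
  \<open>{K \<le> 0}\<close>, so reciprocals converge too.

  For the second part, the change of variables
  \<open>E[g(T\<^sub>n) / L\<^sub>n(T\<^sub>n)] = \<integral> g 1\<^bsub>{L\<^sub>n > 0}\<^esub> dM\<close> turns the tail expectation of \<open>1 / L\<^sub>n(T\<^sub>n)\<close> above
  \<open>c\<close> into \<open>M(0 < L\<^sub>n < 1 / c)\<close>, which Markov's inequality for \<open>log\<^sup>- L\<^sub>n\<close> bounds by a constant over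
  \<open>ln c\<close>, uniformly in \<open>n\<close>. The same bound makes \<open>L\<^sub>n\<close> and \<open>K\<close> almost surely positive; hence all
  reciprocals, including the limit, have expectation one, and Scheffe's argument gives \<open>L\<^sup>1\<close>
  convergence. The final formula is the change of variables for \<open>S\<close>.
\<close>

section \<open>Null sequences of measures and densities\<close>

lemma null_sequence_approx:
  fixes a :: "nat \<Rightarrow> real"
  assumes "\<And>n. 0 \<le> a n"
    and approx: "\<And>\<eta>. \<eta> > 0 \<Longrightarrow> \<exists>b. b \<longlonglongrightarrow> 0 \<and> (\<forall>n. a n \<le> b n + \<eta>)"
  shows "a \<longlonglongrightarrow> 0"
proof (rule LIMSEQ_I)
  fix r :: real assume "r > 0"
  then obtain b where b: "b \<longlonglongrightarrow> 0" "\<And>n. a n \<le> b n + r / 2"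
    using approx[of "r / 2"] by auto
  from b(1) \<open>r > 0\<close> obtain N where "\<And>n. n \<ge> N \<Longrightarrow> \<bar>b n\<bar> < r / 2"
    using LIMSEQ_D[of b 0 "r / 2"] by auto
  then have "norm (a n - 0) < r" if "n \<ge> N" for n
    using b(2)[of n] assms(1)[of n] that by fastforce
  then show "\<exists>N. \<forall>n\<ge>N. norm (a n - 0) < r" by blast
qed

text \<open>The sets decrease to the empty set because \<open>f\<close> has finite values; so a real function is bounded up to
  a set of small measure.\<close>

lemma (in finite_measure) measure_tail_null:
  fixes f :: "'a \<Rightarrow> real"
  assumes "f \<in> borel_measurable M"
  shows "(\<lambda>k. measure M {x \<in> space M. \<bar>f x\<bar> > real k}) \<longlonglongrightarrow> 0"
proof -
  have "(\<lambda>k. measure M {x \<in> space M. \<bar>f x\<bar> > real k})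
      \<longlonglongrightarrow> measure M (\<Inter>k. {x \<in> space M. \<bar>f x\<bar> > real k})"
    using assms by (intro finite_Lim_measure_decseq) (auto simp: decseq_def)
  also have "(\<Inter>k. {x \<in> space M. \<bar>f x\<bar> > real k}) = {}"
    using reals_Archimedean2 by (auto dest: less_asym)
  finally show ?thesis by simp
qed

lemma measure_density_real:
  fixes R :: "'a \<Rightarrow> real"
  assumes "integrable M R" and A[measurable]: "A \<in> sets M"
  shows "measure (density M R) A = (LINT y|M. indicator A y * max 0 (R y))"
proof -
  have [measurable]: "R \<in> borel_measurable M" using assms by simp
  have "emeasure (density M R) A = (\<integral>\<^sup>+y. ennreal (R y) * indicator A y \<partial>M)"
    by (rule emeasure_density) simp_all
  also have "\<dots> = (\<integral>\<^sup>+y. ennreal (indicator A y * max 0 (R y)) \<partial>M)"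
    by (intro nn_integral_cong) (auto split: split_indicator simp: max_def ennreal_neg)
  finally show ?thesis
    by (simp add: measure_def integral_eq_nn_integral)
qed

text \<open>Absolute continuity of \<open>R \<cdot> M\<close> with respect to \<open>M\<close>, in its sequential form. Where \<open>R\<close> is at most
  \<open>k\<close> the density measure is at most \<open>k\<close> times \<open>M\<close>, and the set where \<open>R\<close> exceeds \<open>k\<close> is itself small
  under \<open>R \<cdot> M\<close>.\<close>

lemma (in finite_measure) finite_density_null_sequence:
  fixes R :: "'a \<Rightarrow> real"
  assumes R[measurable]: "R \<in> borel_measurable M"
    and fin: "finite_measure (density M R)"
    and A[measurable]: "\<And>n. A n \<in> sets M"
    and null: "(\<lambda>n. measure M (A n)) \<longlonglongrightarrow> 0"
  shows "(\<lambda>n. measure (density M R) (A n)) \<longlonglongrightarrow> 0"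
proof (rule null_sequence_approx)
  interpret D: finite_measure "density M R" by fact
  fix \<eta> :: real assume "\<eta> > 0"
  obtain k where k: "measure (density M R) {x \<in> space M. \<bar>R x\<bar> > real k} < \<eta>"
    using order_tendstoD(2)[OF D.measure_tail_null[of R] \<open>\<eta> > 0\<close>]
    by (auto simp: eventually_sequentially)
  have "measure (density M R) (A n) \<le> real k * measure M (A n) + \<eta>" for n
  proof -
    let ?B = "{x \<in> space M. \<bar>R x\<bar> > real k}"
    have "emeasure (density M R) (A n - ?B) = (\<integral>\<^sup>+x. ennreal (R x) * indicator (A n - ?B) x \<partial>M)"
      by (rule emeasure_density) simp_all
    also have "\<dots> \<le> (\<integral>\<^sup>+x. ennreal (real k) * indicator (A n) x \<partial>M)"
      using sets.sets_into_space[OF A[of n]]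
      by (intro nn_integral_mono) (auto split: split_indicator simp: not_less intro!: ennreal_leI)
    also have "\<dots> = ennreal (real k * measure M (A n))"
      by (simp add: nn_integral_cmult emeasure_eq_measure ennreal_mult)
    finally have "measure (density M R) (A n - ?B) \<le> real k * measure M (A n)"
      by (simp add: D.emeasure_eq_measure)
    moreover have "measure (density M R) (A n) \<le> measure (density M R) ((A n - ?B) \<union> ?B)"
      by (intro D.finite_measure_mono) auto
    moreover have "\<dots> \<le> measure (density M R) (A n - ?B) + measure (density M R) ?B"
      by (intro measure_Un_le) auto
    ultimately show ?thesis using k by simp
  qed
  then show "\<exists>b. b \<longlonglongrightarrow> 0 \<and> (\<forall>n. measure (density M R) (A n) \<le> b n + \<eta>)"
    using tendsto_mult_right_zero[OF null, of "real k"] by blast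
qed simp

lemma le_zero_if_le_div:
  fixes a b :: real
  assumes "\<And>t. t > 0 \<Longrightarrow> a \<le> b / t"
  shows "a \<le> 0"
proof (rule tendsto_lowerbound)
  show "((\<lambda>t. b / t) \<longlongrightarrow> 0) at_top" by (intro tendsto_divide_0[OF tendsto_const] filterlim_at_top_imp_at_infinity filterlim_ident)
  show "\<forall>\<^sub>F t in at_top. a \<le> b / t" using eventually_gt_at_top[of 0] by eventually_elim (rule assms)
qed simp

section \<open>Convergence in probability and in the mean\<close>

lemma L0_convergesD:
  assumes "L0_converges M f g" "\<epsilon> > 0"
  shows "(\<lambda>n. measure M {x \<in> space M. dist (f n x) (g x) > \<epsilon>}) \<longlonglongrightarrow> 0"
  using assms by (simp add: L0_converges_def)

lemma (in finite_measure) L0_converges_approx: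
  fixes f h :: "nat \<Rightarrow> 'a \<Rightarrow> real"
  assumes f: "L0_converges M f g"
    and h[measurable]: "\<And>n. h n \<in> borel_measurable M"
    and close: "\<And>\<epsilon>. \<epsilon> > 0 \<Longrightarrow> (\<lambda>n. measure M {x \<in> space M. \<bar>h n x - f n x\<bar> > \<epsilon>}) \<longlonglongrightarrow> 0"
  shows "L0_converges M h g"
  unfolding L0_converges_def
proof (intro conjI allI impI)
  have [measurable]: "f n \<in> borel_measurable M" "g \<in> borel_measurable M" for n
    using f by (auto simp: L0_converges_def)
  show "g \<in> borel_measurable M" by simp
  fix \<epsilon> :: real assume "\<epsilon> > 0"
  let ?A = "\<lambda>n. {x \<in> space M. \<bar>h n x - f n x\<bar> > \<epsilon> / 2}"
  let ?B = "\<lambda>n. {x \<in> space M. dist (f n x) (g x) > \<epsilon> / 2}"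
  have "measure M {x \<in> space M. dist (h n x) (g x) > \<epsilon>} \<le> measure M (?A n) + measure M (?B n)" for n
    by (rule order_trans[OF finite_measure_mono measure_Un_le]) (auto simp: dist_real_def abs_real_def)
  moreover have lim: "(\<lambda>n. measure M (?A n) + measure M (?B n)) \<longlonglongrightarrow> 0"
    using tendsto_add[OF close[of "\<epsilon> / 2"] L0_convergesD[OF f, of "\<epsilon> / 2"]] \<open>\<epsilon> > 0\<close> by simp
  ultimately show "(\<lambda>n. measure M {x \<in> space M. dist (h n x) (g x) > \<epsilon>}) \<longlonglongrightarrow> 0"
    by (intro tendsto_sandwich[OF _ _ tendsto_const lim]) simp_all
qed fact

text \<open>The reciprocal is uniformly continuous on \<open>[\<delta>, \<infinity>)\<close> for each \<open>\<delta> > 0\<close>, and a positive \<open>g\<close> falls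
  below \<open>\<delta>\<close> with a probability that vanishes with \<open>\<delta>\<close>.\<close>

lemma (in finite_measure) L0_converges_inverse:
  fixes f :: "nat \<Rightarrow> 'a \<Rightarrow> real"
  assumes f: "L0_converges M f g" and pos: "AE x in M. g x > 0"
  shows "L0_converges M (\<lambda>n x. inverse (f n x)) (\<lambda>x. inverse (g x))"
  unfolding L0_converges_def
proof (intro conjI allI impI)
  have [measurable]: "f n \<in> borel_measurable M" "g \<in> borel_measurable M" for n
    using f by (auto simp: L0_converges_def)
  show "(\<lambda>x. inverse (f n x)) \<in> borel_measurable M" "(\<lambda>x. inverse (g x)) \<in> borel_measurable M" for n
    by simp_all
  fix \<epsilon> :: real assume "\<epsilon> > 0"
  show "(\<lambda>n. measure M {x \<in> space M. dist (inverse (f n x)) (inverse (g x)) > \<epsilon>}) \<longlonglongrightarrow> 0"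
  proof (rule null_sequence_approx)
    fix \<eta> :: real assume "\<eta> > 0"
    obtain k :: nat where k: "measure M {x \<in> space M. \<bar>inverse (g x)\<bar> > real k} < \<eta>"
      using order_tendstoD(2)[OF measure_tail_null[of "\<lambda>x. inverse (g x)"] \<open>\<eta> > 0\<close>]
      by (auto simp: eventually_sequentially)
    define \<delta> where "\<delta> = 1 / real (Suc k)"
    have "\<delta> > 0" by (simp add: \<delta>_def)
    have lower: "g x \<ge> \<delta>" if "g x > 0" "\<bar>inverse (g x)\<bar> \<le> real k" for x
      using that by (simp add: \<delta>_def field_simps)
    \<comment> \<open>The first bound keeps \<open>a\<close> above \<open>\<delta> / 2\<close>; then \<open>|1/a - 1/b| = |a - b| / (a b)\<close> is at most
      \<open>|a - b| / (\<delta>\<^sup>2 / 2)\<close>, which the second bound makes at most \<open>\<epsilon>\<close>.\<close>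
    define \<theta> where "\<theta> = min (\<delta> / 2) (\<epsilon> * \<delta>\<^sup>2 / 2)"
    have "\<theta> > 0" using \<open>\<delta> > 0\<close> \<open>\<epsilon> > 0\<close> by (simp add: \<theta>_def)
    have near: "dist (inverse a) (inverse b) \<le> \<epsilon>" if "b \<ge> \<delta>" "dist a b \<le> \<theta>" for a b :: real
    proof -
      have "a \<ge> \<delta> / 2" using that unfolding \<theta>_def dist_real_def by linarith
      have "\<delta> / 2 * \<delta> \<le> a * b" using \<open>a \<ge> \<delta> / 2\<close> \<open>b \<ge> \<delta>\<close> \<open>\<delta> > 0\<close> by (intro mult_mono) auto
      have "\<bar>a - b\<bar> \<le> \<epsilon> * (\<delta> / 2 * \<delta>)" using that by (simp add: \<theta>_def dist_real_def power2_eq_square)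
      also have "\<dots> \<le> \<epsilon> * (a * b)" using \<open>\<delta> / 2 * \<delta> \<le> a * b\<close> \<open>\<epsilon> > 0\<close> by (intro mult_left_mono) auto
      finally show ?thesis
        using \<open>a \<ge> \<delta> / 2\<close> \<open>b \<ge> \<delta>\<close> \<open>\<delta> > 0\<close>
        by (simp add: dist_real_def inverse_diff_inverse abs_mult divide_simps abs_minus_commute)
    qed
    let ?A = "{x \<in> space M. \<bar>inverse (g x)\<bar> > real k}"
    let ?N = "{x \<in> space M. \<not> g x > 0}"
    let ?B = "\<lambda>n. {x \<in> space M. dist (f n x) (g x) > \<theta>}"
    have N: "measure M ?N = 0" using pos by (intro measure_eq_0_null_sets) (auto simp: AE_iff_null)
    have "measure M {x \<in> space M. dist (inverse (f n x)) (inverse (g x)) > \<epsilon>} \<le> measure M (?B n) + \<eta>" for n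
    proof -
      have "{x \<in> space M. dist (inverse (f n x)) (inverse (g x)) > \<epsilon>} \<subseteq> ?B n \<union> (?A \<union> ?N)"
      proof
        fix x assume "x \<in> {x \<in> space M. dist (inverse (f n x)) (inverse (g x)) > \<epsilon>}"
        then show "x \<in> ?B n \<union> (?A \<union> ?N)"
          using near[of "g x" "f n x"] lower[of x] by auto
      qed
      then have "measure M {x \<in> space M. dist (inverse (f n x)) (inverse (g x)) > \<epsilon>}
          \<le> measure M (?B n \<union> (?A \<union> ?N))"
        by (intro finite_measure_mono) auto
      moreover have "measure M (?B n \<union> (?A \<union> ?N)) \<le> measure M (?B n) + measure M (?A \<union> ?N)"
        "measure M (?A \<union> ?N) \<le> measure M ?A + measure M ?N"
        by (intro measure_Un_le; simp)+
      ultimately show ?thesis using k N by simp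
    qed
    then show "\<exists>b. b \<longlonglongrightarrow> 0 \<and>
        (\<forall>n. measure M {x \<in> space M. dist (inverse (f n x)) (inverse (g x)) > \<epsilon>} \<le> b n + \<eta>)"
      using L0_convergesD[OF f \<open>\<theta> > 0\<close>] by blast
  qed simp
qed

text \<open>Scheffe's lemma, with convergence in probability in place of almost sure convergence. As the
  integrals agree, \<open>\<integral>|f\<^sub>n - g| = 2 \<integral>(g - f\<^sub>n)\<^sup>+\<close>, and the positive part is dominated by \<open>g\<^sup>+\<close>
  because \<open>f\<^sub>n \<ge> 0\<close>.\<close>

lemma (in prob_space) L1_converges_if_integrals_eq:
  fixes f :: "nat \<Rightarrow> 'a \<Rightarrow> real"
  assumes lim: "L0_converges M f g"
    and int: "\<And>n. integrable M (f n)" "integrable M g"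
    and nonneg: "\<And>n. AE x in M. 0 \<le> f n x"
    and eq: "\<And>n. (LINT x|M. f n x) = (LINT x|M. g x)"
  shows "L1_converges M f g"
proof -
  have [measurable]: "f n \<in> borel_measurable M" "g \<in> borel_measurable M" for n using int by auto
  have "(\<lambda>n. LINT x|M. \<bar>f n x - g x\<bar>) \<longlonglongrightarrow> 0"
  proof (rule null_sequence_approx)
    fix \<eta> :: real assume "\<eta> > 0"
    let ?far = "\<lambda>n. {x \<in> space M. dist (f n x) (g x) > \<eta> / 2}"
    have far[measurable]: "?far n \<in> sets M" for n by measurable
    have fin: "finite_measure (density M g)"
      using int(2) by (intro finite_measureI) (simp add: emeasure_density real_integrable_def cong: nn_integral_cong)
    have "(\<lambda>n. measure (density M g) (?far n)) \<longlonglongrightarrow> 0"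
      using L0_convergesD[OF lim, of "\<eta> / 2"] \<open>\<eta> > 0\<close>
      by (intro finite_density_null_sequence fin) auto
    then have "(\<lambda>n. 2 * measure (density M g) (?far n)) \<longlonglongrightarrow> 0"
      by (rule tendsto_mult_right_zero)
    moreover have "(LINT x|M. \<bar>f n x - g x\<bar>) \<le> 2 * measure (density M g) (?far n) + \<eta>" for n
    proof -
      have int_far: "integrable M (\<lambda>x. indicator (?far n) x * max 0 (g x))"
      proof (rule Bochner_Integration.integrable_bound[OF int(2)])
        show "(\<lambda>x. indicator (?far n) x * max 0 (g x)) \<in> borel_measurable M" by measurable
        show "AE x in M. norm (indicator (?far n) x * max 0 (g x)) \<le> norm (g x)"
          by (intro AE_I2) (auto split: split_indicator)
      qed
      have "(LINT x|M. \<bar>f n x - g x\<bar>) = (LINT x|M. (f n x - g x) + 2 * max 0 (g x - f n x))"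
        by (intro Bochner_Integration.integral_cong) (auto simp: max_def abs_real_def)
      also have "\<dots> = 2 * (LINT x|M. max 0 (g x - f n x))"
        using int eq[of n] by simp
      also have "(LINT x|M. max 0 (g x - f n x)) \<le> (LINT x|M. \<eta> / 2 + indicator (?far n) x * max 0 (g x))"
      proof (rule integral_mono_AE)
        show "AE x in M. max 0 (g x - f n x) \<le> \<eta> / 2 + indicator (?far n) x * max 0 (g x)"
          using nonneg[of n] AE_space[of M]
          by eventually_elim (use \<open>\<eta> > 0\<close> in \<open>auto split: split_indicator simp: dist_real_def abs_real_def split: if_splits\<close>)
      qed (use int int_far in auto)
      also have "\<dots> = \<eta> / 2 + measure (density M g) (?far n)"
        using int_far by (simp add: measure_density_real[OF int(2)] prob_space)
      finally show ?thesis by simp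
    qed
    ultimately show "\<exists>b. b \<longlonglongrightarrow> 0 \<and> (\<forall>n. (LINT x|M. \<bar>f n x - g x\<bar>) \<le> b n + \<eta>)" by blast
  qed simp
  then show ?thesis using int by (simp add: L1_converges_def)
qed

section \<open>Passing to the completion\<close>

text \<open>On the completion, a function almost everywhere equal to a measurable one is itself measurable.
  Thus \<open>\<Lambda>(U\<^sub>n)\<close>, built from arbitrary versions of the derivative and the divergence, is a random
  variable there once it is known to agree with \<open>1 / (L\<^sub>n \<circ> U\<^sub>n)\<close>.\<close>

lemma L0_converges_completion:
  fixes f f' :: "nat \<Rightarrow> 'a \<Rightarrow> 'b::{metric_space,second_countable_topology}"
  assumes f: "L0_converges M f g"
    and eq: "\<And>n. AE x in M. f' n x = f n x" 
  shows "L0_converges (completion M) f' g"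
  unfolding L0_converges_def
proof (intro conjI allI impI)
  have [measurable]: "f n \<in> borel_measurable M" "g \<in> borel_measurable M" for n
    using f by (auto simp: L0_converges_def)
  then have g: "g \<in> borel_measurable (completion M)" by (simp add: measurable_completion)
  show f'[measurable]: "f' n \<in> borel_measurable (completion M)" for n
  proof (rule measurableI)
    fix A :: "'b set" assume A: "A \<in> sets borel"
    show "f' n -` A \<inter> space (completion M) \<in> sets (completion M)"
    proof (rule completion.in_sets_AE)
      show "AE x in completion M. x \<in> f n -` A \<inter> space M \<longleftrightarrow> x \<in> f' n -` A \<inter> space (completion M)"
        using AE_completion[OF eq[of n]] by eventually_elim auto
      show "f n -` A \<inter> space M \<in> sets (completion M)"
        using A by (intro sets_completionI_sets measurable_sets[of "f n" M borel]) simp_all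
    qed auto
  qed simp
  show "g \<in> borel_measurable (completion M)" by fact
  fix \<epsilon> :: real assume "\<epsilon> > 0"
  have "measure (completion M) {x \<in> space (completion M). dist (f' n x) (g x) > \<epsilon>}
      = measure M {x \<in> space M. dist (f n x) (g x) > \<epsilon>}" for n
  proof -
    have "measure (completion M) {x \<in> space (completion M). dist (f' n x) (g x) > \<epsilon>}
      = measure (completion M) {x \<in> space M. dist (f n x) (g x) > \<epsilon>}"
    proof (rule measure_eq_AE)
      show "AE x in completion M. x \<in> {x \<in> space (completion M). dist (f' n x) (g x) > \<epsilon>}
          \<longleftrightarrow> x \<in> {x \<in> space M. dist (f n x) (g x) > \<epsilon>}"
        using AE_completion[OF eq[of n]] by eventually_elim auto
      show "{x \<in> space (completion M). dist (f' n x) (g x) > \<epsilon>} \<in> sets (completion M)"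
        using g f'[of n] by measurable
    qed simp
    then show ?thesis by simp
  qed
  then show "(\<lambda>n. measure (completion M) {x \<in> space (completion M). dist (f' n x) (g x) > \<epsilon>}) \<longlonglongrightarrow> 0"
    using L0_convergesD[OF f \<open>\<epsilon> > 0\<close>] by simp
qed

lemma uniformly_integrable_completion:
  assumes f: "uniformly_integrable M f"
    and meas: "\<And>n. f' n \<in> borel_measurable (completion M)"
    and eq: "\<And>n. AE x in M. f' n x = f n x"
  shows "uniformly_integrable (completion M) f'"
proof -
  have "(\<integral>\<^sup>+x. ennreal (\<bar>f' n x\<bar> * indicator {y. \<bar>f' n y\<bar> > c} x) \<partial>completion M)
      = (\<integral>\<^sup>+x. ennreal (\<bar>f n x\<bar> * indicator {y. \<bar>f n y\<bar> > c} x) \<partial>M)" for n c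
    unfolding nn_integral_completion
  proof (rule nn_integral_cong_AE)
    show "AE x in M. ennreal (\<bar>f' n x\<bar> * indicator {y. \<bar>f' n y\<bar> > c} x)
        = ennreal (\<bar>f n x\<bar> * indicator {y. \<bar>f n y\<bar> > c} x)"
      using eq[of n] by eventually_elim (simp add: indicator_def)
  qed
  then show ?thesis using f meas by (simp add: uniformly_integrable_def)
qed

lemma L1_converges_completion:
  assumes f: "L1_converges M f g"
    and meas: "\<And>n. f' n \<in> borel_measurable (completion M)"
    and eq: "\<And>n. AE x in M. f' n x = f n x"
  shows "L1_converges (completion M) f' g"
proof -
  have [measurable]: "f n \<in> borel_measurable M" "g \<in> borel_measurable M" for n
    using f by (auto simp: L1_converges_def)
  have f': "f' n \<in> borel_measurable (completion M)" "f n \<in> borel_measurable (completion M)" for n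
    by (simp_all add: meas measurable_completion)
  have g: "g \<in> borel_measurable (completion M)" by (simp add: measurable_completion)
  have "integrable (completion M) (f' n)" for n
  proof -
    have "integrable (completion M) (f n)"
      using f by (simp add: L1_converges_def integrable_completion)
    then show ?thesis
      using integrable_cong_AE[OF f'(1) f'(2) AE_completion[OF eq[of n]]] by simp
  qed
  moreover have "integrable (completion M) g"
    using f by (simp add: L1_converges_def integrable_completion)
  moreover have "(LINT x|completion M. \<bar>f' n x - g x\<bar>) = (LINT x|M. \<bar>f n x - g x\<bar>)" for n
  proof -
    have "(LINT x|completion M. \<bar>f' n x - g x\<bar>) = (LINT x|completion M. \<bar>f n x - g x\<bar>)"
    proof (rule integral_cong_AE)
      show "AE x in completion M. \<bar>f' n x - g x\<bar> = \<bar>f n x - g x\<bar>"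
        using AE_completion[OF eq[of n]] by eventually_elim simp
    qed (use f' g in simp_all)
    then show ?thesis by (simp add: integral_completion)
  qed
  ultimately show ?thesis using f by (simp add: L1_converges_def)
qed

section \<open>Integrating against the reciprocal of a density\<close>

text \<open>If \<open>X\<close> has law \<open>R \<cdot> M\<close>, then weighting by \<open>1 / R(X)\<close> undoes the density, except on \<open>{R \<le> 0}\<close>, whose
  mass is lost.\<close>

lemma nn_integral_inverse_density:
  assumes X[measurable]: "X \<in> borel_measurable P" and sets[measurable_cong]: "sets M = sets borel"
    and R[measurable]: "R \<in> borel_measurable borel" and g[measurable]: "g \<in> borel_measurable borel"
    and law: "distr P borel X = density M (\<lambda>y. ennreal (R y))"
  shows "(\<integral>\<^sup>+x. ennreal (inverse (R (X x))) * g (X x) \<partial>P) = (\<integral>\<^sup>+y. g y * indicator {y. R y > 0} y \<partial>M)"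
proof -
  have "(\<integral>\<^sup>+x. ennreal (inverse (R (X x))) * g (X x) \<partial>P)
      = (\<integral>\<^sup>+y. ennreal (inverse (R y)) * g y \<partial>distr P borel X)"
    by (subst nn_integral_distr) simp_all
  also have "\<dots> = (\<integral>\<^sup>+y. ennreal (R y) * (ennreal (inverse (R y)) * g y) \<partial>M)"
    unfolding law by (subst nn_integral_density) simp_all
  also have "\<dots> = (\<integral>\<^sup>+y. g y * indicator {y. R y > 0} y \<partial>M)"
    by (intro nn_integral_cong)
      (auto split: split_indicator simp: ennreal_neg not_less mult.assoc[symmetric] simp flip: ennreal_mult)
  finally show ?thesis .
qed

lemma integral_inverse_density:
  fixes R g :: "'b::topological_space \<Rightarrow> real"
  assumes X[measurable]: "X \<in> borel_measurable P" and sets[measurable_cong]: "sets M = sets borel"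
    and R[measurable]: "R \<in> borel_measurable borel" and g[measurable]: "g \<in> borel_measurable borel"
    and law: "distr P borel X = density M R"
  shows "(LINT x|P. g (X x) * inverse (R (X x))) = (LINT y|M. g y * indicator {y. R y > 0} y)"
proof -
  have "(LINT x|P. g (X x) * inverse (R (X x))) = (LINT y|density M (\<lambda>y. ennreal (max 0 (R y))). g y * inverse (R y))"
  proof -
    have "(\<lambda>y. ennreal (R y)) = (\<lambda>y. ennreal (max 0 (R y)))" by (auto simp: max_def ennreal_neg)
    then have law': "density M (\<lambda>y. ennreal (max 0 (R y))) = distr P borel X" using law by simp
    show ?thesis unfolding law' by (subst integral_distr) simp_all
  qed
  also have "\<dots> = (LINT y|M. max 0 (R y) *\<^sub>R (g y * inverse (R y)))"
    by (rule integral_density) simp_all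
  also have "\<dots> = (LINT y|M. g y * indicator {y. R y > 0} y)"
    by (intro Bochner_Integration.integral_cong) (auto split: split_indicator simp: max_def)
  finally show ?thesis .
qed

section \<open>Regularity of Borel measures on Polish spaces\<close>

lemma compact_neighbourhood_in_open:
  fixes C G :: "'a::metric_space set"
  assumes "compact C" "open G" "C \<subseteq> G"
  obtains d where "d > 0" "\<And>x y. x \<in> C \<Longrightarrow> dist x y \<le> d \<Longrightarrow> y \<in> G"
proof -
  obtain e where "e > 0" "\<forall>x\<in>C. ball x e \<subseteq> G"
    using Heine_Borel_lemma[of C "{G}"] assms by auto metis
  then show thesis by (intro that[of "e / 2"]) (auto simp: subset_eq)
qed

lemma
  fixes N :: "'a::polish_space measure"
  assumes fin: "finite_measure N" and sets: "sets N = sets borel" and A: "A \<in> sets borel" and "\<eta> > 0"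
  shows compact_inner_approx: "\<exists>C. compact C \<and> C \<subseteq> A \<and> measure N A < measure N C + \<eta>"
    and open_outer_approx: "\<exists>G. open G \<and> A \<subseteq> G \<and> measure N G < measure N A + \<eta>"
proof -
  interpret finite_measure N by fact
  have top: "emeasure N (space N) \<noteq> \<infinity>" by simp
  have "\<exists>C\<in>{K. K \<subseteq> A \<and> compact K}. emeasure N A < emeasure N C + ennreal \<eta>"
    by (rule SUP_approx_ennreal[OF \<open>\<eta> > 0\<close> _ inner_regular[OF sets top A]]) auto
  then show "\<exists>C. compact C \<and> C \<subseteq> A \<and> measure N A < measure N C + \<eta>"
    using \<open>\<eta> > 0\<close> by (auto simp: emeasure_eq_measure ennreal_less_iff simp flip: ennreal_plus)
  have "\<exists>G\<in>{U. A \<subseteq> U \<and> open U}. emeasure N G < emeasure N A + ennreal \<eta>"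
    by (rule INF_approx_ennreal[OF \<open>\<eta> > 0\<close> outer_regular[OF sets top A]]) simp
  then show "\<exists>G. open G \<and> A \<subseteq> G \<and> measure N G < measure N A + \<eta>"
    using \<open>\<eta> > 0\<close> by (auto simp: emeasure_eq_measure ennreal_less_iff simp flip: ennreal_plus)
qed

section \<open>Maps whose laws have convergent densities\<close>

text \<open>The source space \<open>P\<close> and the target space \<open>M\<close> are kept apart: on a Wiener space both are
  the Wiener measure, but their roles do not mix.\<close>

locale transport_limit = P: prob_space P + M: prob_space M
  for P :: "'a measure" and M :: "'b::polish_space measure" +
  fixes T :: "nat \<Rightarrow> 'a \<Rightarrow> 'b" and S :: "'a \<Rightarrow> 'b" and L :: "nat \<Rightarrow> 'b \<Rightarrow> real" and K :: "'b \<Rightarrow> real"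
  assumes sets_M[measurable_cong]: "sets M = sets borel"
    and T_tendsto: "L0_converges P T S"
    and L_tendsto: "L1_converges M L K"
    and L_nonneg: "\<And>n y. 0 \<le> L n y"
    and distr_T: "\<And>n. distr P borel (T n) = density M (L n)"
begin

lemma integrable_L [simp]: "integrable M (L n)" and integrable_K [simp]: "integrable M K"
  using L_tendsto by (auto simp: L1_converges_def)

lemma measurable_T [measurable]: "T n \<in> borel_measurable P"
  and measurable_S [measurable]: "S \<in> borel_measurable P"
  using T_tendsto by (auto simp: L0_converges_def)

lemma measurable_L [measurable]: "L n \<in> borel_measurable borel"
  and measurable_K [measurable]: "K \<in> borel_measurable borel"
  using integrable_L[of n, THEN borel_measurable_integrable]
    integrable_K[THEN borel_measurable_integrable] measurable_cong_sets[OF sets_M refl]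
  by auto

text \<open>The coercion to extended nonnegative reals replaces negative values of \<open>K\<close> by zero.\<close>

definition \<nu> :: "'b measure" where "\<nu> = density M K"

lemma sets_\<nu> [simp, measurable_cong]: "sets \<nu> = sets borel"
  by (simp add: \<nu>_def sets_M)

lemma space_M: "space M = UNIV" and space_\<nu>: "space \<nu> = UNIV"
  using sets_eq_imp_space_eq[OF sets_M] by (simp_all add: \<nu>_def)

definition err :: "nat \<Rightarrow> real" where "err n = (LINT y|M. \<bar>L n y - K y\<bar>)"

lemma err_tendsto: "err \<longlonglongrightarrow> 0"
  using L_tendsto by (simp add: L1_converges_def err_def[abs_def])

lemma measure_\<nu>: "A \<in> sets borel \<Longrightarrow> measure \<nu> A = (LINT y|M. indicator A y * max 0 (K y))"
  unfolding \<nu>_def by (rule measure_density_real) (simp_all add: sets_M)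

lemma prob_T:
  assumes A[measurable]: "A \<in> sets borel"
  shows "P.prob {x \<in> space P. T n x \<in> A} = (LINT y|M. indicator A y * L n y)"
proof -
  have "P.prob {x \<in> space P. T n x \<in> A} = measure (distr P borel (T n)) A"
    by (subst measure_distr) (auto intro!: arg_cong[where f="P.prob"])
  also have "\<dots> = (LINT y|M. indicator A y * max 0 (L n y))"
    unfolding distr_T by (rule measure_density_real) (simp_all add: sets_M)
  finally show ?thesis using L_nonneg by (simp add: max_absorb2)
qed

text \<open>Total variation convergence: the error \<open>err n\<close> is uniform in the set. Replacing \<open>K\<close> by its positive
  part only helps, as \<open>L n\<close> is nonnegative.\<close>

lemma law_T_near:
  assumes A[measurable]: "A \<in> sets borel"
  shows "\<bar>P.prob {x \<in> space P. T n x \<in> A} - measure \<nu> A\<bar> \<le> err n"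
proof -
  have int: "integrable M (\<lambda>y. indicator A y * L n y)" "integrable M (\<lambda>y. indicator A y * max 0 (K y))"
    by (rule Bochner_Integration.integrable_bound[OF integrable_L[of n]]; simp split: split_indicator)
      (rule Bochner_Integration.integrable_bound[OF integrable_K]; auto split: split_indicator)
  have "P.prob {x \<in> space P. T n x \<in> A} - measure \<nu> A
      = (LINT y|M. indicator A y * L n y - indicator A y * max 0 (K y))"
    using int by (simp add: prob_T measure_\<nu>)
  also have "\<bar>\<dots>\<bar> \<le> (LINT y|M. \<bar>indicator A y * L n y - indicator A y * max 0 (K y)\<bar>)"
    by (rule integral_abs_bound)
  also have "\<dots> \<le> err n"
    unfolding err_def
  proof (rule integral_mono)
    show "\<bar>indicator A y * L n y - indicator A y * max 0 (K y)\<bar> \<le> \<bar>L n y - K y\<bar>" for y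
      using L_nonneg[of n y] by (auto split: split_indicator)
  qed (use int in auto)
  finally show ?thesis .
qed

text \<open>Total masses converge along \<open>law_T_near\<close>, so \<open>\<nu>\<close> inherits mass one.\<close>

sublocale \<nu>: prob_space \<nu>
proof
  have fin: "emeasure \<nu> UNIV \<noteq> \<infinity>"
  proof -
    have "emeasure \<nu> UNIV = (\<integral>\<^sup>+y. ennreal (K y) \<partial>M)"
      unfolding \<nu>_def by (subst emeasure_density) (auto simp: sets_M)
    then show ?thesis using integrable_K by (simp add: real_integrable_def)
  qed
  have "\<bar>1 - measure \<nu> UNIV\<bar> \<le> err n" for n
    using law_T_near[of UNIV n] by (simp add: P.prob_space)
  then have "\<bar>1 - measure \<nu> UNIV\<bar> \<le> 0"
    by (intro LIMSEQ_le_const[OF err_tendsto]) auto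
  then show "emeasure \<nu> (space \<nu>) = 1"
    using fin by (simp add: emeasure_eq_ennreal_measure space_\<nu> top.not_eq_extremum)
qed

lemma far_tendsto: "d > 0 \<Longrightarrow> (\<lambda>n. P.prob {x \<in> space P. dist (T n x) (S x) > d}) \<longlonglongrightarrow> 0"
  by (rule L0_convergesD[OF T_tendsto])

text \<open>A compact set inside \<open>A\<close> has a positive distance \<open>d\<close> from the complement of an open set around \<open>A\<close>. If
  \<open>S\<close> is in the compact set, then \<open>T n\<close> is in the open one unless it is further than \<open>d\<close> from \<open>S\<close>; letting \<open>n\<close>
  tend to infinity bounds the law of \<open>S\<close> by \<open>\<nu>\<close>.\<close>

lemma law_S_le:
  assumes A[measurable]: "A \<in> sets borel"
  shows "P.prob {x \<in> space P. S x \<in> A} \<le> measure \<nu> A"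
proof (rule field_le_epsilon)
  fix \<eta> :: real assume "\<eta> > 0"
  interpret D: prob_space "distr P borel S" by (rule P.prob_space_distr) simp
  obtain C where C: "compact C" "C \<subseteq> A" "measure (distr P borel S) A < measure (distr P borel S) C + \<eta> / 2"
    using compact_inner_approx[OF D.finite_measure_axioms _ A, of "\<eta> / 2"] \<open>\<eta> > 0\<close> by auto
  obtain G where G: "open G" "A \<subseteq> G" "measure \<nu> G < measure \<nu> A + \<eta> / 2"
    using open_outer_approx[OF \<nu>.finite_measure_axioms _ A, of "\<eta> / 2"] \<open>\<eta> > 0\<close> by auto
  note [measurable] = borel_compact[OF C(1)] borel_open[OF G(1)]
  obtain d where d: "d > 0" "\<And>x y. x \<in> C \<Longrightarrow> dist x y \<le> d \<Longrightarrow> y \<in> G"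
    using compact_neighbourhood_in_open[OF C(1) G(1)] C(2) G(2) by blast
  have "P.prob {x \<in> space P. S x \<in> C} \<le> measure \<nu> G"
  proof (rule LIMSEQ_le_const)
    show "(\<lambda>n. measure \<nu> G + err n + P.prob {x \<in> space P. dist (T n x) (S x) > d}) \<longlonglongrightarrow> measure \<nu> G"
      using tendsto_add[OF tendsto_add[OF tendsto_const err_tendsto] far_tendsto[OF d(1)], of "measure \<nu> G"]
      by simp
    have "P.prob {x \<in> space P. S x \<in> C}
      \<le> measure \<nu> G + err n + P.prob {x \<in> space P. dist (T n x) (S x) > d}" for n
    proof -
      have "P.prob {x \<in> space P. S x \<in> C} \<le> P.prob ({x \<in> space P. T n x \<in> G} \<union> {x \<in> space P. dist (T n x) (S x) > d})"
        using d(2) by (intro P.finite_measure_mono) (auto simp: dist_commute not_less)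
      also have "\<dots> \<le> P.prob {x \<in> space P. T n x \<in> G} + P.prob {x \<in> space P. dist (T n x) (S x) > d}"
        by (rule measure_Un_le) auto
      finally show ?thesis using law_T_near[of G n] by simp
    qed
    then show "\<exists>N. \<forall>n\<ge>N. P.prob {x \<in> space P. S x \<in> C}
      \<le> measure \<nu> G + err n + P.prob {x \<in> space P. dist (T n x) (S x) > d}" by blast
  qed
  moreover have "measure (distr P borel S) B = P.prob {x \<in> space P. S x \<in> B}" if "B \<in> sets borel" for B
    using that by (subst measure_distr) (auto intro!: arg_cong[where f="P.prob"])
  ultimately show "P.prob {x \<in> space P. S x \<in> A} \<le> measure \<nu> A + \<eta>"
    using C(3) G(3) by simp
qed

text \<open>Of two probability measures, one cannot lie strictly below the other: apply the bound to the
  complement as well.\<close>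

lemma distr_S: "distr P borel S = \<nu>"
proof (rule measure_eqI)
  interpret D: prob_space "distr P borel S" by (rule P.prob_space_distr) simp
  fix A assume "A \<in> sets (distr P borel S)"
  then have A[measurable]: "A \<in> sets borel" by simp
  have eq: "measure (distr P borel S) B = P.prob {x \<in> space P. S x \<in> B}" if "B \<in> sets borel" for B
    using that by (subst measure_distr) (auto intro!: arg_cong[where f="P.prob"])
  have "measure \<nu> A \<le> measure (distr P borel S) A"
    using law_S_le[of "- A"] eq[of "- A"] D.prob_compl[of A] \<nu>.prob_compl[of A]
    by (simp add: space_\<nu> Compl_eq_Diff_UNIV)
  then have "measure (distr P borel S) A = measure \<nu> A"
    using law_S_le[of A] by (simp add: eq)
  then show "emeasure (distr P borel S) A = emeasure \<nu> A"
    by (simp add: D.emeasure_eq_measure \<nu>.emeasure_eq_measure)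
qed simp

lemma prob_S:
  assumes A[measurable]: "A \<in> sets borel"
  shows "P.prob {x \<in> space P. S x \<in> A} = measure \<nu> A"
  unfolding distr_S[symmetric]
  by (subst measure_distr) (auto intro!: arg_cong[where f="P.prob"])

text \<open>With \<open>C \<subseteq> A \<subseteq> G\<close> compact and open, disagreement about \<open>A\<close> forces \<open>T n\<close> into \<open>A - C\<close>, or \<open>S\<close> into
  \<open>G - A\<close>, or \<open>T n\<close> and \<open>S\<close> to be apart. The first two have small probability because both laws are
  close to \<open>\<nu>\<close>. The opposite disagreement is this statement for the complement of \<open>A\<close>.\<close>

lemma T_in_S_notin_tendsto:
  assumes A[measurable]: "A \<in> sets borel"
  shows "(\<lambda>n. P.prob {x \<in> space P. T n x \<in> A \<and> S x \<notin> A}) \<longlonglongrightarrow> 0"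
proof (rule null_sequence_approx)
  fix \<eta> :: real assume "\<eta> > 0"
  obtain C where C: "compact C" "C \<subseteq> A" "measure \<nu> A < measure \<nu> C + \<eta> / 2"
    using compact_inner_approx[OF \<nu>.finite_measure_axioms _ A, of "\<eta> / 2"] \<open>\<eta> > 0\<close> by auto
  obtain G where G: "open G" "A \<subseteq> G" "measure \<nu> G < measure \<nu> A + \<eta> / 2"
    using open_outer_approx[OF \<nu>.finite_measure_axioms _ A, of "\<eta> / 2"] \<open>\<eta> > 0\<close> by auto
  note [measurable] = borel_compact[OF C(1)] borel_open[OF G(1)]
  obtain d where d: "d > 0" "\<And>x y. x \<in> C \<Longrightarrow> dist x y \<le> d \<Longrightarrow> y \<in> G"
    using compact_neighbourhood_in_open[OF C(1) G(1)] C(2) G(2) by blast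
  let ?far = "\<lambda>n. {x \<in> space P. dist (T n x) (S x) > d}"
  have "P.prob {x \<in> space P. T n x \<in> A \<and> S x \<notin> A} \<le> (err n + P.prob (?far n)) + \<eta>" for n
  proof -
    have "P.prob {x \<in> space P. T n x \<in> A \<and> S x \<notin> A}
        \<le> P.prob ({x \<in> space P. T n x \<in> A - C} \<union> ({x \<in> space P. S x \<in> G - A} \<union> ?far n))"
      using d(2) by (intro P.finite_measure_mono) (auto simp: not_less)
    moreover have "\<dots> \<le> P.prob {x \<in> space P. T n x \<in> A - C} + P.prob ({x \<in> space P. S x \<in> G - A} \<union> ?far n)"
      by (rule measure_Un_le) measurable
    moreover have "P.prob ({x \<in> space P. S x \<in> G - A} \<union> ?far n) \<le> P.prob {x \<in> space P. S x \<in> G - A} + P.prob (?far n)"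
      by (rule measure_Un_le) measurable
    moreover have "P.prob {x \<in> space P. S x \<in> G - A} = measure \<nu> G - measure \<nu> A"
      using G(2) by (simp only: prob_S sets.Diff borel_open[OF G(1)] A) (simp add: \<nu>.finite_measure_Diff)
    moreover have "P.prob {x \<in> space P. T n x \<in> A - C} \<le> measure \<nu> A - measure \<nu> C + err n"
      using law_T_near[of "A - C" n] C(2) by (simp add: \<nu>.finite_measure_Diff del: Diff_iff)
    ultimately show ?thesis using C(3) G(3) by simp
  qed
  moreover have "(\<lambda>n. err n + P.prob (?far n)) \<longlonglongrightarrow> 0"
    using tendsto_add[OF err_tendsto far_tendsto[OF d(1)]] by simp
  ultimately show "\<exists>b. b \<longlonglongrightarrow> 0 \<and> (\<forall>n. P.prob {x \<in> space P. T n x \<in> A \<and> S x \<notin> A} \<le> b n + \<eta>)"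
    by blast
qed simp

text \<open>Cut the range of \<open>h\<close> into intervals of length \<open>\<epsilon>\<close>. If \<open>h (T n)\<close> and \<open>h S\<close> differ by more than \<open>\<epsilon>\<close>,
  they lie in different intervals; up to the small event that \<open>|h S|\<close> is large, only finitely many
  intervals matter, and each contributes a null sequence.\<close>

lemma compose_tendsto:
  fixes h :: "'b \<Rightarrow> real"
  assumes h[measurable]: "h \<in> borel_measurable borel"
  shows "L0_converges P (\<lambda>n x. h (T n x)) (\<lambda>x. h (S x))"
  unfolding L0_converges_def
proof (intro conjI allI impI)
  show "(\<lambda>x. h (T n x)) \<in> borel_measurable P" "(\<lambda>x. h (S x)) \<in> borel_measurable P" for n by simp_all
  fix \<epsilon> :: real assume "\<epsilon> > 0"
  show "(\<lambda>n. P.prob {x \<in> space P. dist (h (T n x)) (h (S x)) > \<epsilon>}) \<longlonglongrightarrow> 0"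
  proof (rule null_sequence_approx)
    fix \<eta> :: real assume "\<eta> > 0"
    obtain k :: nat where k: "measure \<nu> {y. \<bar>h y\<bar> > real k} < \<eta>"
      using order_tendstoD(2)[OF \<nu>.measure_tail_null[of h] \<open>\<eta> > 0\<close>]
      by (auto simp: eventually_sequentially space_\<nu> measurable_cong_sets[OF sets_\<nu> refl])
    define level where "level j = {y. \<lfloor>h y / \<epsilon>\<rfloor> = j}" for j
    define J where "J = {\<lfloor>- real k / \<epsilon>\<rfloor>..\<lfloor>real k / \<epsilon>\<rfloor>}"
    have level[measurable]: "level j \<in> sets borel" for j unfolding level_def by measurable
    let ?cross = "\<lambda>n j. {x \<in> space P. T n x \<in> - level j \<and> S x \<notin> - level j}"
    have same: "dist a b \<le> \<epsilon>" if "\<lfloor>a / \<epsilon>\<rfloor> = \<lfloor>b / \<epsilon>\<rfloor>" for a b :: real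
    proof -
      have "\<bar>a / \<epsilon> - b / \<epsilon>\<bar> \<le> 1" using that by linarith
      then show ?thesis using \<open>\<epsilon> > 0\<close> by (simp add: dist_real_def field_simps flip: diff_divide_distrib)
    qed
    have inJ: "\<lfloor>b / \<epsilon>\<rfloor> \<in> J" if "\<bar>b\<bar> \<le> real k" for b :: real
      using divide_right_mono[of "- real k" b \<epsilon>] divide_right_mono[of b "real k" \<epsilon>] that \<open>\<epsilon> > 0\<close>
      unfolding J_def by (auto intro!: floor_mono)
    have "P.prob {x \<in> space P. dist (h (T n x)) (h (S x)) > \<epsilon>} \<le> (\<Sum>j\<in>J. P.prob (?cross n j)) + \<eta>" for n
    proof -
      have "{x \<in> space P. dist (h (T n x)) (h (S x)) > \<epsilon>}
          \<subseteq> (\<Union>j\<in>J. ?cross n j) \<union> {x \<in> space P. S x \<in> {y. \<bar>h y\<bar> > real k}}"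
      proof
        fix x assume "x \<in> {x \<in> space P. dist (h (T n x)) (h (S x)) > \<epsilon>}"
        then show "x \<in> (\<Union>j\<in>J. ?cross n j) \<union> {x \<in> space P. S x \<in> {y. \<bar>h y\<bar> > real k}}"
          using same[of "h (T n x)" "h (S x)"] inJ[of "h (S x)"] by (auto simp: level_def)
      qed
      then have "P.prob {x \<in> space P. dist (h (T n x)) (h (S x)) > \<epsilon>}
          \<le> P.prob ((\<Union>j\<in>J. ?cross n j) \<union> {x \<in> space P. S x \<in> {y. \<bar>h y\<bar> > real k}})"
        by (intro P.finite_measure_mono sets.Un sets.finite_UN) (auto simp: J_def)
      moreover have "\<dots> \<le> P.prob (\<Union>j\<in>J. ?cross n j) + P.prob {x \<in> space P. S x \<in> {y. \<bar>h y\<bar> > real k}}"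
        by (intro measure_Un_le sets.finite_UN) (auto simp: J_def)
      moreover have "P.prob (\<Union>j\<in>J. ?cross n j) \<le> (\<Sum>j\<in>J. P.prob (?cross n j))"
        by (intro measure_UNION_le) (auto simp: J_def)
      moreover have "P.prob {x \<in> space P. S x \<in> {y. \<bar>h y\<bar> > real k}} = measure \<nu> {y. \<bar>h y\<bar> > real k}"
        by (rule prob_S) measurable
      ultimately show ?thesis using k by simp
    qed
    moreover have "(\<lambda>n. \<Sum>j\<in>J. P.prob (?cross n j)) \<longlonglongrightarrow> 0"
      by (intro tendsto_null_sum T_in_S_notin_tendsto) simp
    ultimately show "\<exists>b. b \<longlonglongrightarrow> 0 \<and>
        (\<forall>n. P.prob {x \<in> space P. dist (h (T n x)) (h (S x)) > \<epsilon>} \<le> b n + \<eta>)"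
      by blast
  qed simp
qed

lemma L_tendsto_in_measure:
  assumes "\<epsilon> > 0"
  shows "(\<lambda>n. M.prob {y. \<bar>L n y - K y\<bar> > \<epsilon>}) \<longlonglongrightarrow> 0"
proof (rule tendsto_sandwich[OF _ _ tendsto_const])
  have "M.prob {y. \<bar>L n y - K y\<bar> > \<epsilon>} \<le> err n / \<epsilon>" for n
  proof -
    have "M.prob {y. \<bar>L n y - K y\<bar> > \<epsilon>} \<le> M.prob {y \<in> space M. \<epsilon> \<le> \<bar>L n y - K y\<bar>}"
      by (intro M.finite_measure_mono) (auto simp: space_M)
    also have "\<dots> \<le> err n / \<epsilon>"
      unfolding err_def using \<open>\<epsilon> > 0\<close>
      by (intro integral_Markov_inequality_measure[where A="{}"]) auto
    finally show ?thesis .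
  qed
  then show "\<forall>\<^sub>F n in sequentially. M.prob {y. \<bar>L n y - K y\<bar> > \<epsilon>} \<le> err n / \<epsilon>" by simp
  show "(\<lambda>n. err n / \<epsilon>) \<longlonglongrightarrow> 0" using tendsto_divide[OF err_tendsto tendsto_const[of \<epsilon>]] assms by simp
qed simp

text \<open>Split \<open>L n (T n) - K S\<close> at \<open>K (T n)\<close>. The event that \<open>L n\<close> and \<open>K\<close> differ at \<open>T n\<close> is the
  event that \<open>T n\<close> hits a set of small \<open>M\<close>-measure, which is therefore small for \<open>\<nu>\<close>.\<close>

theorem density_compose_tendsto: "L0_converges P (\<lambda>n x. L n (T n x)) (\<lambda>x. K (S x))"
proof (rule P.L0_converges_approx[OF compose_tendsto[of K]])
  fix \<epsilon> :: real assume "\<epsilon> > 0"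
  have "(\<lambda>n. measure \<nu> {y. \<bar>L n y - K y\<bar> > \<epsilon>}) \<longlonglongrightarrow> 0"
    unfolding \<nu>_def
    using \<nu>.finite_measure_axioms L_tendsto_in_measure[OF \<open>\<epsilon> > 0\<close>]
    by (intro M.finite_density_null_sequence) (auto simp: \<nu>_def)
  from tendsto_add[OF this err_tendsto]
  have lim: "(\<lambda>n. measure \<nu> {y. \<bar>L n y - K y\<bar> > \<epsilon>} + err n) \<longlonglongrightarrow> 0" by simp
  have "P.prob {x \<in> space P. \<bar>L n (T n x) - K (T n x)\<bar> > \<epsilon>} \<le> measure \<nu> {y. \<bar>L n y - K y\<bar> > \<epsilon>} + err n" for n
    using law_T_near[of "{y. \<bar>L n y - K y\<bar> > \<epsilon>}" n] by simp
  then show "(\<lambda>n. P.prob {x \<in> space P. \<bar>L n (T n x) - K (T n x)\<bar> > \<epsilon>}) \<longlonglongrightarrow> 0"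
    by (intro tendsto_sandwich[OF _ _ tendsto_const lim]) simp_all
qed simp_all

lemma limit_density_pos: "AE x in P. K (S x) > 0"
proof -
  have "measure \<nu> {y. \<not> K y > 0} = (LINT y|M. indicator {y. \<not> K y > 0} y * max 0 (K y))"
    by (rule measure_\<nu>) simp
  also have "\<dots> = 0"
    by (intro integral_eq_zero_AE AE_I2) (auto split: split_indicator)
  finally have "P.prob {x \<in> space P. \<not> K (S x) > 0} = 0"
    using prob_S[of "{y. \<not> K y > 0}"] by simp
  then show ?thesis by (subst AE_iff_measurable[OF _ refl]) (simp_all add: P.emeasure_eq_measure)
qed

theorem inverse_density_compose_tendsto:
  "L0_converges P (\<lambda>n x. inverse (L n (T n x))) (\<lambda>x. inverse (K (S x)))"
  by (rule P.L0_converges_inverse[OF density_compose_tendsto limit_density_pos])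

text \<open>The right-hand side is an inequality because it will arise as the limit of upper bounds.\<close>

lemma AE_M_pos_iff:
  "(AE y in M. R y > 0) \<longleftrightarrow> M.prob {y. R y \<le> 0} \<le> 0" if [measurable]: "R \<in> borel_measurable borel" for R :: "'b \<Rightarrow> real"
proof -
  have "(AE y in M. R y > 0) \<longleftrightarrow> emeasure M {y. R y \<le> 0} = 0"
    by (rule AE_iff_measurable) (auto simp: space_M not_less)
  then show ?thesis by (simp add: M.emeasure_eq_measure measure_le_0_iff)
qed

text \<open>The case of weight one: the reciprocals are probability densities exactly because no mass
  is lost on \<open>{R \<le> 0}\<close>.\<close>

lemma inverse_density_integral_one:
  fixes R :: "'b \<Rightarrow> real"
  assumes X[measurable]: "X \<in> borel_measurable P" and R[measurable]: "R \<in> borel_measurable borel"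
    and law: "distr P borel X = density M R" and pos: "AE y in M. R y > 0"
  shows "integrable P (\<lambda>x. inverse (R (X x)))" "(LINT x|P. inverse (R (X x))) = 1"
    "AE x in P. 0 \<le> inverse (R (X x))"
proof -
  have "AE y in density M R. R y > 0" by (subst AE_density) auto
  then have "AE x in P. R (X x) > 0" unfolding law[symmetric] by (subst (asm) AE_distr_iff) auto
  then show nonneg: "AE x in P. 0 \<le> inverse (R (X x))" by eventually_elim simp
  have "(\<integral>\<^sup>+x. ennreal (inverse (R (X x))) \<partial>P) = (\<integral>\<^sup>+y. indicator {y. R y > 0} y \<partial>M)"
    using nn_integral_inverse_density[OF X sets_M R, of "\<lambda>_. 1"] law by simp
  also have "\<dots> = (\<integral>\<^sup>+y. 1 \<partial>M)"
  proof (rule nn_integral_cong_AE)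
    show "AE y in M. indicator {y. R y > 0} y = (1::ennreal)" using pos by eventually_elim simp
  qed
  finally have one: "(\<integral>\<^sup>+x. ennreal (inverse (R (X x))) \<partial>P) = 1" by (simp add: M.emeasure_space_1)
  then show "integrable P (\<lambda>x. inverse (R (X x)))"
    using nonneg by (intro integrableI_nonneg) simp_all
  show "(LINT x|P. inverse (R (X x))) = 1"
    using nonneg one by (subst integral_eq_nn_integral) simp_all
qed

section \<open>The logarithmic bound\<close>

context
  assumes log_bound: "(SUP n. \<integral>\<^sup>+y. log_minus (L n y) \<partial>M) < \<infinity>"
begin

text \<open>Markov's inequality for \<open>log\<^sup>- L\<^sub>n\<close>; the value \<open>\<infinity>\<close> of \<open>log\<^sup>-\<close> at zero is what lets the set include
  the zeros of \<open>L\<^sub>n\<close>.\<close>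

lemma log_minus_tail:
  obtains b where "\<And>n t. t > 0 \<Longrightarrow> M.prob {y. L n y \<le> exp (- t)} \<le> b / t"
proof -
  let ?B = "SUP n. \<integral>\<^sup>+y. log_minus (L n y) \<partial>M"
  have "M.prob {y. L n y \<le> exp (- t)} \<le> enn2real ?B / t" if "t > 0" for n t
  proof -
    let ?A = "{y. L n y \<le> exp (- t)}"
    have [measurable]: "?A \<in> sets M" by measurable
    have "ennreal (t * M.prob ?A) = (\<integral>\<^sup>+y. ennreal t * indicator ?A y \<partial>M)"
      using \<open>t > 0\<close> by (simp add: nn_integral_cmult M.emeasure_eq_measure ennreal_mult)
    also have "\<dots> \<le> (\<integral>\<^sup>+y. log_minus (L n y) \<partial>M)"
    proof (rule nn_integral_mono)
      show "ennreal t * indicator ?A y \<le> log_minus (L n y)" for y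
      proof (cases "L n y = 0 \<or> y \<notin> ?A")
        case False
        then have "L n y > 0" using L_nonneg[of n y] by simp
        then have "ln (L n y) \<le> - t"
          using False ln_le_cancel_iff[of "L n y" "exp (- t)"] by simp
        then show ?thesis using False by (auto simp: log_minus_def intro!: ennreal_leI)
      qed (auto simp: log_minus_def)
    qed
    also have "\<dots> \<le> ?B" by (intro SUP_upper) simp
    also have "\<dots> = ennreal (enn2real ?B)" using log_bound by simp
    finally show ?thesis using \<open>t > 0\<close> by (simp add: field_simps)
  qed
  then show thesis by (rule that)
qed

lemma AE_L_pos: "AE y in M. L n y > 0"
proof -
  obtain b where b: "\<And>n t. t > 0 \<Longrightarrow> M.prob {y. L n y \<le> exp (- t)} \<le> b / t" using log_minus_tail by blast
  have "M.prob {y. L n y \<le> 0} \<le> b / t" if "t > 0" for t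
    by (rule order_trans[OF M.finite_measure_mono b[OF that, of n]]) (auto intro: order_trans)
  then show ?thesis unfolding AE_M_pos_iff[OF measurable_L] by (rule le_zero_if_le_div)
qed

text \<open>The tail bound on \<open>L\<^sub>n\<close> passes to \<open>K\<close>: where \<open>K \<le> 0\<close>, either \<open>L\<^sub>n\<close> is at most \<open>exp (- t)\<close> or it is far
  from \<open>K\<close>.\<close>

lemma AE_K_pos: "AE y in M. K y > 0"
proof -
  obtain b where b: "\<And>n t. t > 0 \<Longrightarrow> M.prob {y. L n y \<le> exp (- t)} \<le> b / t" using log_minus_tail by blast
  have "M.prob {y. K y \<le> 0} \<le> b / t" if "t > 0" for t
  proof (rule LIMSEQ_le_const)
    let ?far = "\<lambda>n. {y. \<bar>L n y - K y\<bar> > exp (- t) / 2}"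
    show "(\<lambda>n. b / t + M.prob (?far n)) \<longlonglongrightarrow> b / t"
      using tendsto_add[OF tendsto_const L_tendsto_in_measure[of "exp (- t) / 2"], of "b / t"] by simp
    have "M.prob {y. K y \<le> 0} \<le> b / t + M.prob (?far n)" for n
    proof -
      have "y \<in> {y. L n y \<le> exp (- t)} \<union> ?far n" if "K y \<le> 0" for y
        using that exp_gt_zero[of "- t"] unfolding Un_iff mem_Collect_eq by linarith
      then have "M.prob {y. K y \<le> 0} \<le> M.prob ({y. L n y \<le> exp (- t)} \<union> ?far n)"
        by (intro M.finite_measure_mono) auto
      also have "\<dots> \<le> M.prob {y. L n y \<le> exp (- t)} + M.prob (?far n)"
        by (rule measure_Un_le) measurable
      finally show ?thesis using b[OF that, of n] by simp
    qed
    then show "\<exists>N. \<forall>n\<ge>N. M.prob {y. K y \<le> 0} \<le> b / t + M.prob (?far n)" by blast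
  qed
  then show ?thesis unfolding AE_M_pos_iff[OF measurable_K] by (rule le_zero_if_le_div)
qed

text \<open>The change of variables cancels \<open>L\<^sub>n\<close> against its reciprocal, so that the tail expectation becomes
  the mass of \<open>{0 < L\<^sub>n < 1 / c}\<close>. With \<open>t = ln c\<close> this is the event of the tail bound.\<close>

theorem inverse_density_uniformly_integrable:
  "uniformly_integrable P (\<lambda>n x. inverse (L n (T n x)))"
  unfolding uniformly_integrable_def
proof (intro conjI allI)
  obtain b where b: "\<And>n t. t > 0 \<Longrightarrow> M.prob {y. L n y \<le> exp (- t)} \<le> b / t" using log_minus_tail by blast
  let ?I = "\<lambda>c n. \<integral>\<^sup>+x. ennreal (\<bar>inverse (L n (T n x))\<bar> * indicator {x. \<bar>inverse (L n (T n x))\<bar> > c} x) \<partial>P"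
  have bound: "?I c n \<le> ennreal (b / ln c)" if "c > 1" for c n
  proof -
    have "?I c n = (\<integral>\<^sup>+x. ennreal (inverse (L n (T n x))) * indicator {y. inverse (L n y) > c} (T n x) \<partial>P)"
      using L_nonneg by (intro nn_integral_cong) (auto split: split_indicator)
    also have "\<dots> = (\<integral>\<^sup>+y. indicator {y. inverse (L n y) > c} y * indicator {y. L n y > 0} y \<partial>M)"
      by (rule nn_integral_inverse_density[OF _ sets_M _ _ distr_T]) simp_all
    also have "\<dots> \<le> (\<integral>\<^sup>+y. indicator {y. L n y \<le> exp (- ln c)} y \<partial>M)"
    proof (rule nn_integral_mono)
      have "L n y \<le> exp (- ln c)" if "inverse (L n y) > c" "L n y > 0" for y
        using that \<open>c > 1\<close> by (simp add: exp_minus field_simps)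
      then show "indicator {y. inverse (L n y) > c} y * indicator {y. L n y > 0} y
          \<le> (indicator {y. L n y \<le> exp (- ln c)} y :: ennreal)" for y
        by (auto split: split_indicator)
    qed
    also have "\<dots> = ennreal (M.prob {y. L n y \<le> exp (- ln c)})"
      by (subst nn_integral_indicator) (simp_all add: M.emeasure_eq_measure)
    also have "\<dots> \<le> ennreal (b / ln c)" using b[of "ln c" n] \<open>c > 1\<close> by (intro ennreal_leI) simp
    finally show ?thesis .
  qed
  show "((\<lambda>c. SUP n. ?I c n) \<longlongrightarrow> 0) at_top"
  proof (rule tendsto_sandwich[OF _ _ tendsto_const])
    show "\<forall>\<^sub>F c in at_top. (SUP n. ?I c n) \<le> ennreal (b / ln c)"
      using eventually_gt_at_top[of 1] by eventually_elim (intro SUP_least bound)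
    have "((\<lambda>c. b / ln c) \<longlongrightarrow> 0) at_top"
      by (intro tendsto_divide_0[OF tendsto_const] filterlim_at_top_imp_at_infinity ln_at_top)
    then show "((\<lambda>c. ennreal (b / ln c)) \<longlongrightarrow> 0) at_top"
      using tendsto_ennrealI by fastforce
  qed simp
qed simp

theorem integral_inverse_limit_density:
  fixes f :: "'b \<Rightarrow> real"
  assumes f[measurable]: "f \<in> borel_measurable borel"
  shows "(LINT x|P. f (S x) * inverse (K (S x))) = (LINT y|M. f y)"
proof -
  have "(LINT x|P. f (S x) * inverse (K (S x))) = (LINT y|M. f y * indicator {y. K y > 0} y)"
    by (rule integral_inverse_density[OF _ sets_M]) (simp_all add: distr_S \<nu>_def)
  also have "\<dots> = (LINT y|M. f y)"
  proof (rule integral_cong_AE)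
    show "AE y in M. f y * indicator {y. K y > 0} y = f y"
      using AE_K_pos by eventually_elim simp
  qed simp_all
  finally show ?thesis .
qed

theorem inverse_density_L1_converges:
  "L1_converges P (\<lambda>n x. inverse (L n (T n x))) (\<lambda>x. inverse (K (S x)))"
proof -
  note T = inverse_density_integral_one[OF measurable_T measurable_L distr_T AE_L_pos]
  note S = inverse_density_integral_one[OF measurable_S measurable_K _ AE_K_pos, OF distr_S[unfolded \<nu>_def]]
  show ?thesis
    by (rule P.L1_converges_if_integrals_eq[OF inverse_density_compose_tendsto]) (use T S in simp_all)
qed

end
end

section \<open>Wiener shifts\<close>

text \<open>Converting the Radon-Nikodym derivative to a real function is harmless, as the law of \<open>T\<close> is
  finite and its density hence finite almost everywhere.\<close>

lemma density_image_density:
  fixes \<mu> :: "'w::separable_frechet_space measure"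
  assumes "prob_space \<mu>" and sets: "sets \<mu> = sets borel" and T: "T \<in> borel_measurable \<mu>"
    and ac: "absolutely_continuous \<mu> (distr \<mu> borel T)"
  shows "distr \<mu> borel T = density \<mu> (image_density \<mu> T)"
proof -
  interpret prob_space \<mu> by fact
  interpret D: prob_space "distr \<mu> borel T" using T by (rule prob_space_distr)
  have "AE w in \<mu>. RN_deriv \<mu> (distr \<mu> borel T) w \<noteq> \<infinity>"
    by (rule RN_deriv_finite) (use ac sets in \<open>auto intro: D.sigma_finite_measure_axioms\<close>)
  then have "AE w in \<mu>. ennreal (image_density \<mu> T w) = RN_deriv \<mu> (distr \<mu> borel T) w"
    by eventually_elim (auto simp: image_density_def less_top)
  then have "density \<mu> (image_density \<mu> T) = density \<mu> (RN_deriv \<mu> (distr \<mu> borel T))"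
    by (intro density_cong) (auto simp: image_density_def[abs_def])
  also have "\<dots> = distr \<mu> borel T"
    by (rule density_RN_deriv) (use ac sets in auto)
  finally show ?thesis by simp
qed

theorem proposition5:
  fixes \<mu> :: "'w::separable_frechet_space measure"
    and \<iota> :: "'h::{real_inner,polish_space} \<Rightarrow> 'w"
    and p :: real
    and u :: "nat \<Rightarrow> 'w \<Rightarrow> 'h"
    and ulim :: "'w \<Rightarrow> 'w"
    and U :: "nat \<Rightarrow> 'w \<Rightarrow> 'w" and Ulim :: "'w \<Rightarrow> 'w"
    and L :: "nat \<Rightarrow> 'w \<Rightarrow> real" and Llim :: "'w \<Rightarrow> real"
    and \<Lambda> :: "nat \<Rightarrow> 'w \<Rightarrow> real"
  defines "U \<equiv> \<lambda>n. wiener_shift \<iota> (u n)"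
    and "Ulim \<equiv> \<lambda>w. w + ulim w"
    and "L \<equiv> \<lambda>n. image_density \<mu> (U n)"
    and "\<Lambda> \<equiv> \<lambda>n. Lambda \<mu> \<iota> p (u n)"
  assumes "abstract_wiener_space \<mu> \<iota>"
    and "p > 1"
    and "\<And>n. u n \<in> sobolev_space \<mu> \<iota> p"
    and "\<And>n. absolutely_continuous \<mu> (distr \<mu> borel (U n))"
    and "\<And>n. AE w in \<mu>. L n (U n w) * \<Lambda> n w = 1"
    and "L1_converges \<mu> L Llim"
    and "L0_converges \<mu> U Ulim"
  shows "L0_converges \<mu> (\<lambda>n w. L n (U n w)) (\<lambda>w. Llim (Ulim w)) \<and>
    (\<exists>lam. lam \<in> borel_measurable \<mu> \<and>
       L0_converges (completion \<mu>) \<Lambda> lam \<and>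
       (AE w in \<mu>. Llim (Ulim w) * lam w = 1) \<and>
       ((SUP n. \<integral>\<^sup>+ w. log_minus (L n w) \<partial>\<mu>) < \<infinity> \<longrightarrow>
          uniformly_integrable (completion \<mu>) \<Lambda> \<and>
          L1_converges (completion \<mu>) \<Lambda> lam \<and>
          (\<forall>f :: 'w \<Rightarrow> real. continuous_on UNIV f \<and> bounded (range f) \<longrightarrow>
             (LINT w|\<mu>. f (Ulim w) * lam w) = (LINT w|\<mu>. f w))))"
proof -
  have \<mu>: "prob_space \<mu>" and sets: "sets \<mu> = sets borel"
    using \<open>abstract_wiener_space \<mu> \<iota>\<close> by (simp_all add: abstract_wiener_space_def)
  have U: "U n \<in> borel_measurable \<mu>" for n
    using \<open>L0_converges \<mu> U Ulim\<close> by (simp add: L0_converges_def)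
  interpret transport_limit \<mu> \<mu> U Ulim L Llim
  proof (intro transport_limit.intro transport_limit_axioms.intro)
    show "0 \<le> L n y" for n y by (simp add: L_def image_density_def)
    show "distr \<mu> borel (U n) = density \<mu> (L n)" for n
      unfolding L_def by (rule density_image_density[OF \<mu> sets U assms(8)])
  qed fact+
  let ?lam = "\<lambda>w. inverse (Llim (Ulim w))"
  have \<Lambda>: "AE w in \<mu>. \<Lambda> n w = inverse (L n (U n w))" for n
    using assms(9)[of n] by eventually_elim (metis inverse_unique)
  note conv = L0_converges_completion[OF inverse_density_compose_tendsto \<Lambda>]
  have \<Lambda>_meas: "\<Lambda> n \<in> borel_measurable (completion \<mu>)" for n
    using conv by (simp add: L0_converges_def)
  show ?thesis
  proof (intro conjI exI[of _ ?lam] impI allI)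
    show "AE w in \<mu>. Llim (Ulim w) * ?lam w = 1" using limit_density_pos by eventually_elim simp
    assume log: "(SUP n. \<integral>\<^sup>+ w. log_minus (L n w) \<partial>\<mu>) < \<infinity>"
    show "uniformly_integrable (completion \<mu>) \<Lambda>"
      by (rule uniformly_integrable_completion[OF inverse_density_uniformly_integrable[OF log] \<Lambda>_meas \<Lambda>])
    show "L1_converges (completion \<mu>) \<Lambda> ?lam"
      by (rule L1_converges_completion[OF inverse_density_L1_converges[OF log] \<Lambda>_meas \<Lambda>])
    fix f :: "'w \<Rightarrow> real" assume "continuous_on UNIV f \<and> bounded (range f)"
    then show "(LINT w|\<mu>. f (Ulim w) * ?lam w) = (LINT w|\<mu>. f w)"
      by (intro integral_inverse_limit_density[OF log] borel_measurable_continuous_onI) simp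
  qed (simp_all add: density_compose_tendsto conv)
qed

end
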